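(* Let $\mathbf{L}\in\mathbf{DQD}$ with $|L|>2$. Then the following are equivalent: (1) $\mathbf{L}$ is a subdirectly irreducible algebra in $\mathbf{JIDL_1}$; (2) $\mathbf{L}$ is a simple algebra in $\mathbf{JIDL_1}$; (3) $\mathbf{L}\in\mathbf{JIDL_1}$ and, for every $x\in L$, if $x\neq 1$ then $x\wedge (x')^*=0$; (4) $\mathbf{L}\cong\mathbf{D_2}$, or $\mathbf{L}$ is a $\mathbf{DStH}$-chain.
   Context: A semi-Heyting algebra is an algebra $\langle L,\vee,\wedge,\to,0,1\rangle$ such that $\langle L,\vee,\wedge,0,1\rangle$ is a bounded lattice and the identities $x\wedge(x\to y)\approx x\wedge y$, $x\wedge(y\to z)\approx x\wedge[(x\wedge y)\to(x\wedge z)]$, $x\to x\approx 1$ hold; it is a Heyting algebra if moreover $(x\wedge y)\to y\approx 1$. Write $x^*:=x\to 0$. A $\mathbf{DQD}$-algebra (dually quasi-De Morgan semi-Heyting algebra) is an algebra $\langle L,\vee,\wedge,\to,{}',0,1\rangle$ whose reduct $\langle L,\vee,\wedge,\to,0,1\rangle$ is a semi-Heyting algebra and which satisfies: $0'\approx 1$ and $1'\approx 0$; $(x\wedge y)'\approx x'\vee y'$; $(x\vee y)''\approx x''\vee y''$; $x''\le x$. $\mathbf{DQD}$ denotes the variety of all $\mathbf{DQD}$-algebras. $\mathbf{JIDL_1}$ is the subvariety of $\mathbf{DQD}$ defined by the identities $x'\vee(y\to z)\approx(x'\vee y)\to(x'\vee z)$, $(x\to y)\vee(y\to x)\approx 1$,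 and $x\wedge x'^{*}\approx (x\wedge x'^{*})'^{*}$ (where $z'^*$ means $(z')^*$); in the presence of the first identity, the last is equivalent to the level-1 identity $x\wedge x'^*\approx x\wedge x'^*\wedge x'^*{}'^*$. A $\mathbf{DStH}$-chain is a $\mathbf{DQD}$-algebra satisfying $x'\wedge x''\approx 0$ whose semi-Heyting reduct is a Heyting algebra and whose lattice reduct is a chain. $\mathbf{D_2}$ is the $\mathbf{DQD}$-algebra whose reduct without $'$ is the four-element Boolean algebra $\{0,a,b,1\}$ with its Heyting implication ($x\to y$ is the join of the complement of $x$ with $y$), and with $0'=1$, $1'=0$, $a'=a$, $b'=b$. *)

theory Defs
  imports "HOL-Library.FuncSet" "HOL-Library.Product_Order" "HOL-Algebra.Congruence"
begin

text \<open>
  Algebras of the signature of dually quasi-De Morgan semi-Heyting algebras. The unary operation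
  written as a postfix prime in the literature is the prefix operator \<open>\<sim>\<close> here.
\<close>

record 'a alg = "'a partial_object" +
  vee  :: "['a, 'a] \<Rightarrow> 'a"  (infixl \<open>\<squnion>\<index>\<close> 65)
  wedge :: "['a, 'a] \<Rightarrow> 'a"  (infixl \<open>\<sqinter>\<index>\<close> 70)
  imp  :: "['a, 'a] \<Rightarrow> 'a"  (infixr \<open>\<leadsto>\<index>\<close> 60)
  dqn  :: "'a \<Rightarrow> 'a"  (\<open>\<sim>\<index> _\<close> [90] 90)
  zero :: 'a  (\<open>\<zero>\<index>\<close>)
  one  :: 'a  (\<open>\<one>\<index>\<close>)

locale algebra =
  fixes L :: "'a alg" (structure)
  assumes vee_closed: "\<lbrakk>x \<in> carrier L; y \<in> carrier L\<rbrakk> \<Longrightarrow> x \<squnion> y \<in> carrier L"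
    and wedge_closed: "\<lbrakk>x \<in> carrier L; y \<in> carrier L\<rbrakk> \<Longrightarrow> x \<sqinter> y \<in> carrier L"
    and imp_closed: "\<lbrakk>x \<in> carrier L; y \<in> carrier L\<rbrakk> \<Longrightarrow> x \<leadsto> y \<in> carrier L"
    and dqn_closed: "x \<in> carrier L \<Longrightarrow> \<sim> x \<in> carrier L"
    and zero_closed: "\<zero> \<in> carrier L"
    and one_closed: "\<one> \<in> carrier L"

definition le :: "'a alg \<Rightarrow> 'a \<Rightarrow> 'a \<Rightarrow> bool"  (infix \<open>\<sqsubseteq>\<index>\<close> 50)
  where "x \<sqsubseteq>\<^bsub>L\<^esub> y \<longleftrightarrow> x \<sqinter>\<^bsub>L\<^esub> y = x"

definition star :: "'a alg \<Rightarrow> 'a \<Rightarrow> 'a"  (\<open>\<star>\<index> _\<close> [90] 90)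
  where "\<star>\<^bsub>L\<^esub> x = x \<leadsto>\<^bsub>L\<^esub> \<zero>\<^bsub>L\<^esub>"


subsection \<open>The classes of algebras\<close>

locale bounded_lattice_alg = algebra +
  assumes vee_commute: "\<lbrakk>x \<in> carrier L; y \<in> carrier L\<rbrakk> \<Longrightarrow> x \<squnion> y = y \<squnion> x"
    and wedge_commute: "\<lbrakk>x \<in> carrier L; y \<in> carrier L\<rbrakk> \<Longrightarrow> x \<sqinter> y = y \<sqinter> x"
    and vee_assoc: "\<lbrakk>x \<in> carrier L; y \<in> carrier L; z \<in> carrier L\<rbrakk>
      \<Longrightarrow> (x \<squnion> y) \<squnion> z = x \<squnion> (y \<squnion> z)"
    and wedge_assoc: "\<lbrakk>x \<in> carrier L; y \<in> carrier L; z \<in> carrier L\<rbrakk>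
      \<Longrightarrow> (x \<sqinter> y) \<sqinter> z = x \<sqinter> (y \<sqinter> z)"
    and vee_wedge_absorb: "\<lbrakk>x \<in> carrier L; y \<in> carrier L\<rbrakk> \<Longrightarrow> x \<squnion> (x \<sqinter> y) = x"
    and wedge_vee_absorb: "\<lbrakk>x \<in> carrier L; y \<in> carrier L\<rbrakk> \<Longrightarrow> x \<sqinter> (x \<squnion> y) = x"
    and zero_vee: "x \<in> carrier L \<Longrightarrow> \<zero> \<squnion> x = x"
    and one_wedge: "x \<in> carrier L \<Longrightarrow> \<one> \<sqinter> x = x"

locale semi_heyting = bounded_lattice_alg +
  assumes wedge_imp: "\<lbrakk>x \<in> carrier L; y \<in> carrier L\<rbrakk> \<Longrightarrow> x \<sqinter> (x \<leadsto> y) = x \<sqinter> y"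
    and wedge_imp_distrib: "\<lbrakk>x \<in> carrier L; y \<in> carrier L; z \<in> carrier L\<rbrakk>
      \<Longrightarrow> x \<sqinter> (y \<leadsto> z) = x \<sqinter> ((x \<sqinter> y) \<leadsto> (x \<sqinter> z))"
    and imp_self: "x \<in> carrier L \<Longrightarrow> x \<leadsto> x = \<one>"

locale heyting = semi_heyting +
  assumes wedge_imp_one: "\<lbrakk>x \<in> carrier L; y \<in> carrier L\<rbrakk> \<Longrightarrow> (x \<sqinter> y) \<leadsto> y = \<one>"

locale dqd = semi_heyting +
  assumes dqn_zero: "\<sim> \<zero> = \<one>"
    and dqn_one: "\<sim> \<one> = \<zero>"
    and dqn_wedge: "\<lbrakk>x \<in> carrier L; y \<in> carrier L\<rbrakk> \<Longrightarrow> \<sim> (x \<sqinter> y) = \<sim> x \<squnion> \<sim> y"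
    and dqn_dqn_vee: "\<lbrakk>x \<in> carrier L; y \<in> carrier L\<rbrakk>
      \<Longrightarrow> \<sim> (\<sim> (x \<squnion> y)) = \<sim> (\<sim> x) \<squnion> \<sim> (\<sim> y)"
    and dqn_dqn_le: "x \<in> carrier L \<Longrightarrow> \<sim> (\<sim> x) \<sqsubseteq> x"

locale jidl1 = dqd +
  assumes dqn_vee_imp: "\<lbrakk>x \<in> carrier L; y \<in> carrier L; z \<in> carrier L\<rbrakk>
      \<Longrightarrow> \<sim> x \<squnion> (y \<leadsto> z) = (\<sim> x \<squnion> y) \<leadsto> (\<sim> x \<squnion> z)"
    and linear: "\<lbrakk>x \<in> carrier L; y \<in> carrier L\<rbrakk> \<Longrightarrow> (x \<leadsto> y) \<squnion> (y \<leadsto> x) = \<one>"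
    and level_one: "x \<in> carrier L \<Longrightarrow> x \<sqinter> \<star> (\<sim> x) = \<star> (\<sim> (x \<sqinter> \<star> (\<sim> x)))"

locale dsth_chain = dqd + heyting +
  assumes dqn_wedge_dqn_dqn: "x \<in> carrier L \<Longrightarrow> \<sim> x \<sqinter> \<sim> (\<sim> x) = \<zero>"
    and chain: "\<lbrakk>x \<in> carrier L; y \<in> carrier L\<rbrakk> \<Longrightarrow> x \<sqsubseteq> y \<or> y \<sqsubseteq> x"

definition D2 :: "(bool \<times> bool) alg"
  where "D2 = \<lparr>carrier = UNIV, vee = sup, wedge = inf, imp = (\<lambda>x y. sup (- x) y),
    dqn = (\<lambda>x. if x = bot then top else if x = top then bot else x), zero = bot, one = top\<rparr>"


subsection \<open>Homomorphisms, congruences, simplicity\<close>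

definition hom :: "'a alg \<Rightarrow> 'b alg \<Rightarrow> ('a \<Rightarrow> 'b) set"
  where "hom L M = {h \<in> carrier L \<rightarrow> carrier M.
    (\<forall>x\<in>carrier L. \<forall>y\<in>carrier L. h (x \<squnion>\<^bsub>L\<^esub> y) = h x \<squnion>\<^bsub>M\<^esub> h y \<and>
      h (x \<sqinter>\<^bsub>L\<^esub> y) = h x \<sqinter>\<^bsub>M\<^esub> h y \<and> h (x \<leadsto>\<^bsub>L\<^esub> y) = h x \<leadsto>\<^bsub>M\<^esub> h y) \<and>
    (\<forall>x\<in>carrier L. h (\<sim>\<^bsub>L\<^esub> x) = \<sim>\<^bsub>M\<^esub> (h x)) \<and>
    h \<zero>\<^bsub>L\<^esub> = \<zero>\<^bsub>M\<^esub> \<and> h \<one>\<^bsub>L\<^esub> = \<one>\<^bsub>M\<^esub>}"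

definition iso :: "'a alg \<Rightarrow> 'b alg \<Rightarrow> ('a \<Rightarrow> 'b) set"
  where "iso L M = {h \<in> hom L M. bij_betw h (carrier L) (carrier M)}"

definition is_iso :: "'a alg \<Rightarrow> 'b alg \<Rightarrow> bool"  (infix \<open>\<cong>\<close> 60)
  where "L \<cong> M \<longleftrightarrow> iso L M \<noteq> {}"

definition congruence :: "'a alg \<Rightarrow> ('a \<times> 'a) set \<Rightarrow> bool"
  where "congruence L \<theta> \<longleftrightarrow> equiv (carrier L) \<theta> \<and>
    (\<forall>(x, x')\<in>\<theta>. \<forall>(y, y')\<in>\<theta>. (x \<squnion>\<^bsub>L\<^esub> y, x' \<squnion>\<^bsub>L\<^esub> y') \<in> \<theta> \<and>
      (x \<sqinter>\<^bsub>L\<^esub> y, x' \<sqinter>\<^bsub>L\<^esub> y') \<in> \<theta> \<and> (x \<leadsto>\<^bsub>L\<^esub> y, x' \<leadsto>\<^bsub>L\<^esub> y') \<in> \<theta>) \<and>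
    (\<forall>(x, x')\<in>\<theta>. (\<sim>\<^bsub>L\<^esub> x, \<sim>\<^bsub>L\<^esub> x') \<in> \<theta>)"

definition simple :: "'a alg \<Rightarrow> bool"
  where "simple L \<longleftrightarrow> {\<theta>. congruence L \<theta>} = {Id_on (carrier L), carrier L \<times> carrier L}"


subsection \<open>Subdirect irreducibility\<close>

definition prod_alg :: "'i set \<Rightarrow> ('i \<Rightarrow> 'a alg) \<Rightarrow> ('i \<Rightarrow> 'a) alg"
  where "prod_alg I A = \<lparr>carrier = (\<Pi>\<^sub>E i\<in>I. carrier (A i)),
    vee = (\<lambda>f g. \<lambda>i\<in>I. f i \<squnion>\<^bsub>A i\<^esub> g i), wedge = (\<lambda>f g. \<lambda>i\<in>I. f i \<sqinter>\<^bsub>A i\<^esub> g i),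
    imp = (\<lambda>f g. \<lambda>i\<in>I. f i \<leadsto>\<^bsub>A i\<^esub> g i), dqn = (\<lambda>f. \<lambda>i\<in>I. \<sim>\<^bsub>A i\<^esub> (f i)),
    zero = (\<lambda>i\<in>I. \<zero>\<^bsub>A i\<^esub>), one = (\<lambda>i\<in>I. \<one>\<^bsub>A i\<^esub>)\<rparr>"

definition subdirect_embedding ::
    "'a alg \<Rightarrow> 'i set \<Rightarrow> ('i \<Rightarrow> 'b alg) \<Rightarrow> ('a \<Rightarrow> 'i \<Rightarrow> 'b) \<Rightarrow> bool"
  where "subdirect_embedding L I A \<alpha> \<longleftrightarrow> (\<forall>i\<in>I. algebra (A i)) \<and>
    \<alpha> \<in> hom L (prod_alg I A) \<and> inj_on \<alpha> (carrier L) \<and>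
    (\<forall>i\<in>I. (\<lambda>x. \<alpha> x i) ` carrier L = carrier (A i))"

text \<open>
  An algebra is subdirectly irreducible if each of its subdirect embeddings has a coordinate that
  is an isomorphism. A definition cannot quantify over the types of the index set and of the
  factors, so these are fixed to types that accommodate every family of quotients of the algebra;
  the lemma below shows that the property then holds for subdirect embeddings of all types.
\<close>

definition subdirectly_irreducible :: "'a alg \<Rightarrow> bool"
  where "subdirectly_irreducible L \<longleftrightarrow>
    (\<forall>(I :: ('a \<times> 'a) set set) (A :: ('a \<times> 'a) set \<Rightarrow> 'a set alg) \<alpha>.
      subdirect_embedding L I A \<alpha> \<longrightarrow> (\<exists>i\<in>I. (\<lambda>x. \<alpha> x i) \<in> iso L (A i)))"

definition transport :: "('b \<Rightarrow> 'c) \<Rightarrow> 'b alg \<Rightarrow> 'c alg"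
  where "transport c B = (let d = inv_into (carrier B) c in
    \<lparr>carrier = c ` carrier B,
    vee = (\<lambda>X Y. c (d X \<squnion>\<^bsub>B\<^esub> d Y)), wedge = (\<lambda>X Y. c (d X \<sqinter>\<^bsub>B\<^esub> d Y)),
    imp = (\<lambda>X Y. c (d X \<leadsto>\<^bsub>B\<^esub> d Y)), dqn = (\<lambda>X. c (\<sim>\<^bsub>B\<^esub> (d X))),
    zero = c \<zero>\<^bsub>B\<^esub>, one = c \<one>\<^bsub>B\<^esub>\<rparr>)"

lemma algebra_transport:
  assumes "algebra B" and "inj_on c (carrier B)"
  shows "algebra (transport c B)"
  using assms by (auto simp: algebra_def transport_def Let_def)

lemma subdirectly_irreducibleD:
  fixes L :: "'a alg" and J :: "'j set" and B :: "'j \<Rightarrow> 'b alg"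
  assumes "algebra L" and si: "subdirectly_irreducible L" and emb: "subdirect_embedding L J B \<beta>"
  shows "\<exists>j\<in>J. (\<lambda>x. \<beta> x j) \<in> iso L (B j)"
proof -
  define K where "K j = {(x, y). x \<in> carrier L \<and> y \<in> carrier L \<and> \<beta> x j = \<beta> y j}" for j
  define s where "s \<theta> = (SOME j. j \<in> J \<and> K j = \<theta>)" for \<theta>
  define c where "c j b = {x \<in> carrier L. \<beta> x j = b}" for j b
  define A where "A \<theta> = transport (c (s \<theta>)) (B (s \<theta>))" for \<theta>
  define \<alpha> where "\<alpha> x = (\<lambda>\<theta>\<in>K ` J. c (s \<theta>) (\<beta> x (s \<theta>)))" for x
  have s: "s \<theta> \<in> J" "K (s \<theta>) = \<theta>" if "\<theta> \<in> K ` J" for \<theta>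
  proof -
    have "s \<theta> \<in> J \<and> K (s \<theta>) = \<theta>"
      unfolding s_def by (rule someI_ex) (use that in blast)
    then show "s \<theta> \<in> J" "K (s \<theta>) = \<theta>" by auto
  qed
  have alg: "algebra (B j)" and onto: "(\<lambda>x. \<beta> x j) ` carrier L = carrier (B j)" if "j \<in> J" for j
    using emb that by (auto simp: subdirect_embedding_def)
  have hom: "\<beta> \<in> hom L (prod_alg J B)" and inj: "inj_on \<beta> (carrier L)"
    using emb by (auto simp: subdirect_embedding_def)
  have ext: "\<beta> x \<in> extensional J" if "x \<in> carrier L" for x
    using hom that by (auto simp: hom_def prod_alg_def PiE_def)
  have injc: "inj_on (c j) (carrier (B j))" if "j \<in> J" for j
    unfolding onto[OF that, symmetric] by (auto simp: inj_on_def c_def)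
  have mem: "\<beta> x j \<in> carrier (B j)" if "j \<in> J" "x \<in> carrier L" for j x
    using onto[OF that(1)] that(2) by blast
  have \<beta>hom: "(\<lambda>x. \<beta> x j) \<in> hom L (B j)" if "j \<in> J" for j
    using hom that mem[OF that] by (auto simp: hom_def prod_alg_def)
  have "algebra (A \<theta>)" if "\<theta> \<in> K ` J" for \<theta>
    unfolding A_def using s(1)[OF that] by (intro algebra_transport alg injc)
  moreover have "\<alpha> \<in> hom L (prod_alg (K ` J) A)"
  proof -
    have inv: "inv_into (carrier (B (s \<theta>))) (c (s \<theta>)) (c (s \<theta>) (\<beta> x (s \<theta>))) = \<beta> x (s \<theta>)"
      if "\<theta> \<in> K ` J" "x \<in> carrier L" for \<theta> x
      using s(1)[OF that(1)] that(2) by (intro inv_into_f_f injc mem)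
    have h: "(\<lambda>x. \<beta> x (s \<theta>)) \<in> hom L (B (s \<theta>))" if "\<theta> \<in> K ` J" for \<theta>
      by (rule \<beta>hom[OF s(1)[OF that]])
    show ?thesis
      unfolding hom_def[of L "prod_alg (K ` J) A"]
    proof (intro CollectI conjI ballI)
      show "\<alpha> \<in> carrier L \<rightarrow> carrier (prod_alg (K ` J) A)"
        using mem s by (auto simp: prod_alg_def \<alpha>_def A_def transport_def Let_def)
    next
      fix x y assume xy: "x \<in> carrier L" "y \<in> carrier L"
      note [simp] = inv[OF _ xy(1)] inv[OF _ xy(2)]
      note [simp] = prod_alg_def \<alpha>_def A_def transport_def Let_def
      show "\<alpha> (x \<squnion>\<^bsub>L\<^esub> y) = \<alpha> x \<squnion>\<^bsub>prod_alg (K ` J) A\<^esub> \<alpha> y"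
        using h xy by (simp add: hom_def cong: restrict_cong)
      show "\<alpha> (x \<sqinter>\<^bsub>L\<^esub> y) = \<alpha> x \<sqinter>\<^bsub>prod_alg (K ` J) A\<^esub> \<alpha> y"
        using h xy by (simp add: hom_def cong: restrict_cong)
      show "\<alpha> (x \<leadsto>\<^bsub>L\<^esub> y) = \<alpha> x \<leadsto>\<^bsub>prod_alg (K ` J) A\<^esub> \<alpha> y"
        using h xy by (simp add: hom_def cong: restrict_cong)
    next
      fix x assume x: "x \<in> carrier L"
      note [simp] = inv[OF _ x] prod_alg_def \<alpha>_def A_def transport_def Let_def
      show "\<alpha> (\<sim>\<^bsub>L\<^esub> x) = \<sim>\<^bsub>prod_alg (K ` J) A\<^esub> (\<alpha> x)"
        using h x by (simp add: hom_def cong: restrict_cong)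
    next
      note [simp] = prod_alg_def \<alpha>_def A_def transport_def Let_def
      show "\<alpha> \<zero>\<^bsub>L\<^esub> = \<zero>\<^bsub>prod_alg (K ` J) A\<^esub>"
        using h by (simp add: hom_def cong: restrict_cong)
      show "\<alpha> \<one>\<^bsub>L\<^esub> = \<one>\<^bsub>prod_alg (K ` J) A\<^esub>"
        using h by (simp add: hom_def cong: restrict_cong)
    qed
  qed
  moreover have "inj_on \<alpha> (carrier L)"
  proof (rule inj_onI)
    fix x y assume xy: "x \<in> carrier L" "y \<in> carrier L" "\<alpha> x = \<alpha> y"
    have "\<beta> x j = \<beta> y j" if "j \<in> J" for j
    proof -
      have "K j \<in> K ` J" using that by blast
      then have "c (s (K j)) (\<beta> x (s (K j))) = c (s (K j)) (\<beta> y (s (K j)))"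
        using fun_cong[OF xy(3), of "K j"] by (simp add: \<alpha>_def)
      then have "\<beta> x (s (K j)) = \<beta> y (s (K j))"
        using xy by (auto simp: c_def)
      then have "(x, y) \<in> K (s (K j))" using xy by (simp add: K_def)
      then have "(x, y) \<in> K j" using s(2)[OF \<open>K j \<in> K ` J\<close>] by simp
      then show ?thesis by (simp add: K_def)
    qed
    then have "\<beta> x = \<beta> y" using ext xy by (auto intro: extensionalityI)
    then show "x = y" using inj xy by (auto dest: inj_onD)
  qed
  moreover have "(\<lambda>x. \<alpha> x \<theta>) ` carrier L = carrier (A \<theta>)" if "\<theta> \<in> K ` J" for \<theta>
    using that unfolding A_def transport_def Let_def
    by (simp add: \<alpha>_def image_image flip: onto[OF s(1)[OF that]])
  ultimately have "subdirect_embedding L (K ` J) A \<alpha>"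
    unfolding subdirect_embedding_def by (intro conjI ballI)
  from si[unfolded subdirectly_irreducible_def, rule_format, OF this]
  obtain \<theta> where \<theta>: "\<theta> \<in> K ` J"
    and iso: "(\<lambda>x. \<alpha> x \<theta>) \<in> iso L (A \<theta>)" ..
  have "inj_on (\<lambda>x. \<beta> x (s \<theta>)) (carrier L)"
  proof -
    have "inj_on (\<lambda>x. c (s \<theta>) (\<beta> x (s \<theta>))) (carrier L)"
      using iso \<theta> by (auto simp: iso_def bij_betw_def \<alpha>_def)
    then show ?thesis by (auto simp: inj_on_def)
  qed
  then show ?thesis
    using s(1)[OF \<theta>] \<beta>hom onto by (auto simp: iso_def bij_betw_def)
qed

end

theory Submission
  imports Defs
begin

text \<open>
  Simplicity is a statement about filters, because a congruence of a semi-Heyting algebra is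
  determined by the class of \<open>\<one>\<close>. If that class contains \<open>u \<noteq> \<one>\<close>, it contains \<open>u \<sqinter> \<star> (\<sim> u)\<close>; when
  this is \<open>\<zero>\<close>, everything collapses (\<open>simple_if_wedge_star_dqn_zero\<close>). Conversely, the level-one
  identity says that \<open>y = x \<sqinter> \<star> (\<sim> x)\<close> satisfies \<open>y = \<star> (\<sim> y)\<close>, and the distribution of \<open>\<sim> y \<squnion> _\<close>
  over \<open>\<leadsto>\<close> gives \<open>\<sim> y \<squnion> \<star> (\<sim> y) = \<one>\<close>. So \<open>y\<close> and \<open>\<sim> y\<close> are complementary, truncation at each of
  them is a homomorphism, and the algebra splits as the product of the intervals below \<open>y\<close> and
  \<open>\<sim> y\<close>. In a subdirectly irreducible algebra one factor is trivial, hence \<open>y = \<zero>\<close> or \<open>x = \<one>\<close>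
  (\<open>wedge_star_dqn_zero_if_subdirectly_irreducible\<close>). Simple nontrivial algebras are subdirectly
  irreducible, since some coordinate of a subdirect embedding separates \<open>\<zero>\<close> from \<open>\<one>\<close>.

  For the classification, prelinearity forces the implication to be a Heyting implication
  (\<open>heyting_if_prelinear\<close>). If \<open>x \<sqinter> \<star> (\<sim> x) = \<zero>\<close> for all \<open>x \<noteq> \<one>\<close>, meeting such an \<open>x\<close> with
  \<open>\<sim> x \<squnion> \<star> (\<sim> x) = \<one>\<close> gives \<open>x \<sqsubseteq> \<sim> x\<close>; applied to \<open>\<sim> x\<close> as well, this leaves only \<open>\<sim> x = \<one>\<close> or
  \<open>\<sim> x = x\<close> (\<open>dqn_cases\<close>). A fixed point and its complement exhaust the algebra together with the
  bounds, which gives \<open>D2\<close>; without fixed points, \<open>\<one>\<close> is join-irreducible and prelinearity makes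
  the order a chain. The identities of the two families are checked directly.
\<close>

section \<open>Order and distributivity in semi-Heyting algebras\<close>

context bounded_lattice_alg
begin

lemma wedge_idem: "x \<in> carrier L \<Longrightarrow> x \<sqinter> x = x"
  by (metis vee_wedge_absorb wedge_vee_absorb wedge_closed)

lemma vee_idem: "x \<in> carrier L \<Longrightarrow> x \<squnion> x = x"
  by (metis vee_wedge_absorb wedge_idem)

lemma le_iff_vee: "\<lbrakk>x \<in> carrier L; y \<in> carrier L\<rbrakk> \<Longrightarrow> x \<sqsubseteq> y \<longleftrightarrow> x \<squnion> y = y"
  unfolding le_def by (metis vee_wedge_absorb wedge_vee_absorb vee_commute wedge_commute)

lemma le_refl: "x \<in> carrier L \<Longrightarrow> x \<sqsubseteq> x"
  by (simp add: le_def wedge_idem)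

lemma le_antisym: "\<lbrakk>x \<sqsubseteq> y; y \<sqsubseteq> x; x \<in> carrier L; y \<in> carrier L\<rbrakk> \<Longrightarrow> x = y"
  unfolding le_def by (metis wedge_commute)

lemma le_trans:
  "\<lbrakk>x \<sqsubseteq> y; y \<sqsubseteq> z; x \<in> carrier L; y \<in> carrier L; z \<in> carrier L\<rbrakk> \<Longrightarrow> x \<sqsubseteq> z"
  unfolding le_def by (metis wedge_assoc)

lemma wedge_le1: "\<lbrakk>x \<in> carrier L; y \<in> carrier L\<rbrakk> \<Longrightarrow> x \<sqinter> y \<sqsubseteq> x"
  unfolding le_def by (metis wedge_assoc wedge_commute wedge_idem)

lemma wedge_le2: "\<lbrakk>x \<in> carrier L; y \<in> carrier L\<rbrakk> \<Longrightarrow> x \<sqinter> y \<sqsubseteq> y"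
  by (metis wedge_commute wedge_le1)

lemma le_wedgeI:
  "\<lbrakk>z \<sqsubseteq> x; z \<sqsubseteq> y; x \<in> carrier L; y \<in> carrier L; z \<in> carrier L\<rbrakk> \<Longrightarrow> z \<sqsubseteq> x \<sqinter> y"
  unfolding le_def by (metis wedge_assoc)

lemma le_vee1: "\<lbrakk>x \<in> carrier L; y \<in> carrier L\<rbrakk> \<Longrightarrow> x \<sqsubseteq> x \<squnion> y"
  unfolding le_def by (rule wedge_vee_absorb)

lemma le_vee2: "\<lbrakk>x \<in> carrier L; y \<in> carrier L\<rbrakk> \<Longrightarrow> y \<sqsubseteq> x \<squnion> y"
  by (metis vee_commute le_vee1)

lemma vee_leI:
  "\<lbrakk>x \<sqsubseteq> z; y \<sqsubseteq> z; x \<in> carrier L; y \<in> carrier L; z \<in> carrier L\<rbrakk> \<Longrightarrow> x \<squnion> y \<sqsubseteq> z"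
  using vee_assoc[of x y z] by (simp add: le_iff_vee vee_closed)

lemma zero_le: "x \<in> carrier L \<Longrightarrow> \<zero> \<sqsubseteq> x"
  by (simp add: le_iff_vee zero_vee zero_closed)

lemma le_one: "x \<in> carrier L \<Longrightarrow> x \<sqsubseteq> \<one>"
  unfolding le_def by (metis one_closed one_wedge wedge_commute)

lemma vee_zero: "x \<in> carrier L \<Longrightarrow> x \<squnion> \<zero> = x"
  by (metis vee_commute zero_closed zero_vee)

lemma wedge_one: "x \<in> carrier L \<Longrightarrow> x \<sqinter> \<one> = x"
  by (metis one_closed one_wedge wedge_commute)

lemma zero_wedge: "x \<in> carrier L \<Longrightarrow> \<zero> \<sqinter> x = \<zero>"
  using zero_le by (simp add: le_def)

lemma wedge_zero: "x \<in> carrier L \<Longrightarrow> x \<sqinter> \<zero> = \<zero>"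
  by (metis wedge_commute zero_closed zero_wedge)

lemma one_vee: "x \<in> carrier L \<Longrightarrow> \<one> \<squnion> x = \<one>"
  by (metis le_iff_vee le_one one_closed vee_commute)

lemma vee_one: "x \<in> carrier L \<Longrightarrow> x \<squnion> \<one> = \<one>"
  by (metis one_closed one_vee vee_commute)

lemmas unit_simps = vee_zero zero_vee wedge_one one_wedge zero_wedge wedge_zero one_vee vee_one
  zero_closed one_closed

end

context semi_heyting
begin

text \<open>Half of the existence of relative pseudocomplements, which is what distributivity needs: the
  largest \<open>y\<close> with \<open>x \<sqinter> y \<sqsubseteq> w\<close> is \<open>x \<leadsto> x \<sqinter> w\<close>,
  although it need not be \<open>x \<leadsto> w\<close>.\<close>

lemma le_imp_wedge:
  assumes "x \<sqinter> y \<sqsubseteq> w" and [simp]: "x \<in> carrier L" "y \<in> carrier L" "w \<in> carrier L"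
  shows "y \<sqsubseteq> x \<leadsto> x \<sqinter> w"
proof -
  have "y \<sqinter> (x \<sqinter> w) = y \<sqinter> x"
    using assms by (metis le_def wedge_assoc wedge_commute)
  then have "y \<sqinter> (x \<leadsto> x \<sqinter> w) = y \<sqinter> (y \<sqinter> x \<leadsto> y \<sqinter> x)"
    using wedge_imp_distrib[of y x "x \<sqinter> w"] by (simp add: wedge_closed)
  then show ?thesis by (simp add: le_def imp_self wedge_closed wedge_one)
qed

lemma wedge_vee_distrib:
  assumes [simp]: "x \<in> carrier L" "y \<in> carrier L" "z \<in> carrier L"
  shows "x \<sqinter> (y \<squnion> z) = (x \<sqinter> y) \<squnion> (x \<sqinter> z)"
proof (rule le_antisym)
  note [simp] = vee_closed wedge_closed imp_closed
  let ?w = "(x \<sqinter> y) \<squnion> (x \<sqinter> z)"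
  have "y \<sqsubseteq> x \<leadsto> x \<sqinter> ?w" "z \<sqsubseteq> x \<leadsto> x \<sqinter> ?w"
    by (auto intro!: le_imp_wedge le_vee1 le_vee2)
  then have "y \<squnion> z \<sqsubseteq> x \<leadsto> x \<sqinter> ?w" by (simp add: vee_leI)
  then have "x \<sqinter> (y \<squnion> z) \<sqsubseteq> x \<sqinter> (x \<leadsto> x \<sqinter> ?w)"
    by (intro le_wedgeI) (auto intro: wedge_le1 le_trans[OF wedge_le2])
  also have "x \<sqinter> (x \<leadsto> x \<sqinter> ?w) = x \<sqinter> ?w"
    by (simp add: wedge_imp wedge_assoc[symmetric] wedge_idem)
  finally show "x \<sqinter> (y \<squnion> z) \<sqsubseteq> ?w"
    by (rule le_trans) (auto intro: wedge_le2)
  show "?w \<sqsubseteq> x \<sqinter> (y \<squnion> z)"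
    by (intro le_wedgeI vee_leI)
      (auto intro: wedge_le1 le_trans[OF wedge_le2 le_vee1] le_trans[OF wedge_le2 le_vee2])
qed (simp_all add: vee_closed wedge_closed)

lemma vee_wedge_distrib:
  "\<lbrakk>x \<in> carrier L; y \<in> carrier L; z \<in> carrier L\<rbrakk> \<Longrightarrow> (y \<squnion> z) \<sqinter> x = (y \<sqinter> x) \<squnion> (z \<sqinter> x)"
  by (metis wedge_commute vee_closed wedge_vee_distrib)

lemma one_imp: "x \<in> carrier L \<Longrightarrow> \<one> \<leadsto> x = x"
  by (metis one_closed imp_closed one_wedge wedge_imp)

lemma imp_one_le: "\<lbrakk>x \<leadsto> y = \<one>; x \<in> carrier L; y \<in> carrier L\<rbrakk> \<Longrightarrow> x \<sqsubseteq> y"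
  unfolding le_def by (metis wedge_imp wedge_one)

lemma star_closed: "x \<in> carrier L \<Longrightarrow> \<star> x \<in> carrier L"
  by (simp add: star_def imp_closed zero_closed)

lemma wedge_star: "x \<in> carrier L \<Longrightarrow> x \<sqinter> \<star> x = \<zero>"
  by (simp add: star_def wedge_imp zero_closed wedge_zero)

text \<open>Prelinearity makes the implication of a semi-Heyting algebra a Heyting implication. It yields
  \<open>x \<leadsto> \<one> = \<one>\<close>, and for \<open>x \<sqsubseteq> y\<close> the element \<open>y \<leadsto> x\<close> lies below \<open>x \<leadsto> y\<close>.\<close>

lemma heyting_if_prelinear:
  assumes lin: "\<And>x y. \<lbrakk>x \<in> carrier L; y \<in> carrier L\<rbrakk> \<Longrightarrow> (x \<leadsto> y) \<squnion> (y \<leadsto> x) = \<one>"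
  shows "heyting L"
proof unfold_locales
  fix s y assume [simp]: "s \<in> carrier L" "y \<in> carrier L"
  note [simp] = vee_closed wedge_closed imp_closed zero_closed one_closed
  define x where "x = s \<sqinter> y"
  have [simp]: "x \<in> carrier L" by (simp add: x_def)
  have xy: "x \<sqinter> y = x" by (simp add: x_def wedge_assoc wedge_idem)
  define w where "w = y \<leadsto> x"
  have [simp]: "w \<in> carrier L" by (simp add: w_def)
  have wy: "y \<sqinter> w = x"
    using wedge_imp[of y x] xy by (simp add: w_def wedge_commute)
  then have wx: "w \<sqinter> x = x" "w \<sqinter> y = x"
    by (metis \<open>w \<in> carrier L\<close> \<open>y \<in> carrier L\<close> wedge_commute wedge_assoc wedge_idem)+
  have "w \<sqinter> (x \<leadsto> y) = w \<sqinter> (w \<sqinter> x \<leadsto> w \<sqinter> y)"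
    by (rule wedge_imp_distrib) simp_all
  then have "w \<sqsubseteq> x \<leadsto> y"
    by (simp add: wx imp_self wedge_one le_def)
  moreover have "(x \<leadsto> y) \<squnion> w = \<one>" using lin[of x y] by (simp add: w_def)
  ultimately have "x \<leadsto> y = \<one>"
    by (metis le_iff_vee vee_commute \<open>w \<in> carrier L\<close> \<open>x \<in> carrier L\<close> \<open>y \<in> carrier L\<close> imp_closed)
  then show "s \<sqinter> y \<leadsto> y = \<one>" by (simp add: x_def)
qed

end

context heyting
begin

lemma le_imp_one: "\<lbrakk>x \<sqsubseteq> y; x \<in> carrier L; y \<in> carrier L\<rbrakk> \<Longrightarrow> x \<leadsto> y = \<one>"
  by (metis le_def wedge_imp_one)

lemma le_imp: "\<lbrakk>x \<in> carrier L; y \<in> carrier L\<rbrakk> \<Longrightarrow> y \<sqsubseteq> x \<leadsto> y"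
  using wedge_imp_distrib[of y x y] wedge_imp_one[of y x]
  by (simp add: le_def wedge_idem wedge_one) (metis wedge_commute wedge_imp_one wedge_one)

end

section \<open>Quasi-De Morgan negation\<close>

context dqd
begin

lemma dqn_antimono: "\<lbrakk>x \<sqsubseteq> y; x \<in> carrier L; y \<in> carrier L\<rbrakk> \<Longrightarrow> \<sim> y \<sqsubseteq> \<sim> x"
  using dqn_wedge[of x y] le_vee2[of "\<sim> x" "\<sim> y"] by (simp add: le_def dqn_closed)

lemma dqn_dqn_dqn: "x \<in> carrier L \<Longrightarrow> \<sim> \<sim> \<sim> x = \<sim> x"
  by (intro le_antisym dqn_dqn_le dqn_antimono dqn_closed)

text \<open>An element \<open>j\<close> with \<open>j \<sqinter> \<sim> j = \<zero>\<close> defines a quotient of the algebra, realised on the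
  interval below \<open>j\<close>, because the map \<open>x \<mapsto> x \<sqinter> j\<close> respects the negation.\<close>

lemma dqn_wedge_relative:
  assumes "j \<sqinter> \<sim> j = \<zero>" and [simp]: "x \<in> carrier L" "j \<in> carrier L"
  shows "\<sim> x \<sqinter> j = \<sim> (x \<sqinter> j) \<sqinter> j"
  using assms(1) by (simp add: dqn_wedge vee_wedge_distrib dqn_closed vee_zero wedge_closed
      wedge_commute[of "\<sim> j" j])

end

section \<open>Simplicity and subdirect irreducibility\<close>

lemma (in algebra) congruence_Id_on: "congruence L (Id_on (carrier L))"
  by (auto simp: congruence_def equiv_def refl_on_def sym_def trans_def
      vee_closed wedge_closed imp_closed dqn_closed)

lemma (in algebra) congruence_full: "congruence L (carrier L \<times> carrier L)"
  by (auto simp: congruence_def equiv_def refl_on_def sym_def trans_def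
      vee_closed wedge_closed imp_closed dqn_closed)

text \<open>A congruence relating \<open>x\<close> and \<open>y\<close> relates \<open>x \<leadsto> y\<close> and \<open>y \<leadsto> x\<close> to \<open>\<one>\<close>, so a nontrivial one
  relates some \<open>u \<noteq> \<one>\<close> to \<open>\<one>\<close>, and therefore \<open>u \<sqinter> \<star> (\<sim> u) = \<zero>\<close> to \<open>\<one>\<close>.\<close>

lemma (in dqd) simple_if_wedge_star_dqn_zero:
  assumes cond: "\<And>x. \<lbrakk>x \<in> carrier L; x \<noteq> \<one>\<rbrakk> \<Longrightarrow> x \<sqinter> \<star> (\<sim> x) = \<zero>"
  shows "simple L"
proof -
  have "\<theta> = carrier L \<times> carrier L" if cg: "congruence L \<theta>" and ne: "\<theta> \<noteq> Id_on (carrier L)" for \<theta>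
  proof -
    from cg have eq: "equiv (carrier L) \<theta>" by (simp add: congruence_def)
    have sub: "\<theta> \<subseteq> carrier L \<times> carrier L" and rf: "\<And>x. x \<in> carrier L \<Longrightarrow> (x, x) \<in> \<theta>"
      and sy: "\<And>x y. (x, y) \<in> \<theta> \<Longrightarrow> (y, x) \<in> \<theta>"
      and tr: "\<And>x y z. (x, y) \<in> \<theta> \<Longrightarrow> (y, z) \<in> \<theta> \<Longrightarrow> (x, z) \<in> \<theta>"
      using eq by (auto simp: equiv_def refl_on_def dest: symD transD)
    have c_wedge: "\<And>x x' y y'. (x, x') \<in> \<theta> \<Longrightarrow> (y, y') \<in> \<theta> \<Longrightarrow> (x \<sqinter> y, x' \<sqinter> y') \<in> \<theta>"
      and c_imp: "\<And>x x' y y'. (x, x') \<in> \<theta> \<Longrightarrow> (y, y') \<in> \<theta> \<Longrightarrow> (x \<leadsto> y, x' \<leadsto> y') \<in> \<theta>"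
      and c_dqn: "\<And>x x'. (x, x') \<in> \<theta> \<Longrightarrow> (\<sim> x, \<sim> x') \<in> \<theta>"
      using cg by (fastforce simp: congruence_def)+
    obtain x y where xy: "(x, y) \<in> \<theta>" "x \<noteq> y" "x \<in> carrier L" "y \<in> carrier L"
      using ne sub rf by (auto simp: Id_on_def)
    have "(x \<leadsto> y, \<one>) \<in> \<theta>" "(y \<leadsto> x, \<one>) \<in> \<theta>"
      using c_imp[OF xy(1) rf[OF xy(4)]] c_imp[OF rf[OF xy(4)] xy(1)] by (simp_all add: imp_self xy)
    moreover have "x \<leadsto> y \<noteq> \<one> \<or> y \<leadsto> x \<noteq> \<one>"
      using xy imp_one_le le_antisym by blast
    ultimately obtain u where u: "u \<in> carrier L" "(u, \<one>) \<in> \<theta>" "u \<noteq> \<one>"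
      using xy imp_closed by blast
    have "(\<star> (\<sim> u), \<one>) \<in> \<theta>"
      using c_imp[OF c_dqn[OF u(2)] rf[OF zero_closed]] by (simp add: star_def dqn_one imp_self zero_closed)
    from c_wedge[OF u(2) this] have 01: "(\<zero>, \<one>) \<in> \<theta>"
      using u by (simp add: cond one_closed one_wedge)
    have 0: "(\<zero>, z) \<in> \<theta>" if z: "z \<in> carrier L" for z
      using c_wedge[OF 01 rf[OF z]] z by (simp add: zero_wedge one_wedge)
    have "(y, z) \<in> \<theta>" if "y \<in> carrier L" "z \<in> carrier L" for y z
      by (rule tr[OF sy[OF 0[OF that(1)]] 0[OF that(2)]])
    with sub show ?thesis by auto
  qed
  then show ?thesis
    unfolding simple_def using congruence_Id_on congruence_full by blast
qed

lemma congruence_kernel: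
  assumes "algebra L" and h: "h \<in> hom L M"
  shows "congruence L {(x, y). x \<in> carrier L \<and> y \<in> carrier L \<and> h x = h y}"
  using assms by (auto simp: congruence_def hom_def equiv_def refl_on_def sym_def trans_def algebra_def)

lemma simple_imp_subdirectly_irreducible:
  fixes L :: "'a alg" (structure)
  assumes "algebra L" and "simple L" and nt: "\<zero> \<noteq> \<one>"
  shows "subdirectly_irreducible L"
  unfolding subdirectly_irreducible_def
proof (intro allI impI)
  interpret algebra L by fact
  fix I :: "('a \<times> 'a) set set" and A :: "('a \<times> 'a) set \<Rightarrow> 'a set alg" and \<alpha>
  assume emb: "subdirect_embedding L I A \<alpha>"
  have hom: "\<alpha> \<in> hom L (prod_alg I A)" and inj: "inj_on \<alpha> (carrier L)"
    and onto: "\<And>i. i \<in> I \<Longrightarrow> (\<lambda>x. \<alpha> x i) ` carrier L = carrier (A i)"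
    using emb by (auto simp: subdirect_embedding_def)
  have ext: "\<alpha> x \<in> extensional I" if "x \<in> carrier L" for x
    using hom that by (auto simp: hom_def prod_alg_def PiE_def)
  have "\<alpha> \<zero> \<noteq> \<alpha> \<one>"
    using inj nt zero_closed one_closed by (auto dest: inj_onD)
  then obtain i where i: "i \<in> I" "\<alpha> \<zero> i \<noteq> \<alpha> \<one> i"
    using ext[OF zero_closed] ext[OF one_closed] by (meson extensionalityI)
  have hi: "(\<lambda>x. \<alpha> x i) \<in> hom L (A i)"
    using hom i(1) onto[OF i(1)] by (auto simp: hom_def prod_alg_def)
  define \<theta> where "\<theta> = {(x, y). x \<in> carrier L \<and> y \<in> carrier L \<and> \<alpha> x i = \<alpha> y i}"
  have "\<theta> \<in> {\<theta>. congruence L \<theta>}"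
    using congruence_kernel[OF assms(1) hi] by (simp add: \<theta>_def)
  then have "\<theta> = Id_on (carrier L) \<or> \<theta> = carrier L \<times> carrier L"
    using assms(2) unfolding simple_def by simp
  moreover have "(\<zero>, \<one>) \<notin> \<theta>" "(\<zero>, \<one>) \<in> carrier L \<times> carrier L"
    using i by (auto simp: \<theta>_def zero_closed one_closed)
  ultimately have Id: "\<theta> = Id_on (carrier L)" by metis
  have "inj_on (\<lambda>x. \<alpha> x i) (carrier L)"
  proof (rule inj_onI)
    fix x y assume "x \<in> carrier L" "y \<in> carrier L" "\<alpha> x i = \<alpha> y i"
    then have "(x, y) \<in> \<theta>" by (simp add: \<theta>_def)
    then show "x = y" unfolding Id by (simp add: Id_on_iff)
  qed
  then show "\<exists>i\<in>I. (\<lambda>x. \<alpha> x i) \<in> iso L (A i)"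
    using i hi onto[OF i(1)] by (auto simp: iso_def bij_betw_def)
qed

lemma hom_prod_algI:
  assumes "algebra L" and "\<And>i. i \<in> I \<Longrightarrow> (\<lambda>x. f x i) \<in> hom L (A i)"
  shows "(\<lambda>x. \<lambda>i\<in>I. f x i) \<in> hom L (prod_alg I A)"
  using assms by (auto simp: hom_def prod_alg_def algebra_def Pi_iff cong: restrict_cong)

text \<open>The interval below \<open>j\<close>, with \<open>j\<close> as the unit and with the implication and the negation of \<open>L\<close>
  cut down to it by meeting with \<open>j\<close>.\<close>

definition interval_alg :: "'a alg \<Rightarrow> 'a \<Rightarrow> 'a alg"
  where "interval_alg L j = \<lparr>carrier = {x \<in> carrier L. x \<sqsubseteq>\<^bsub>L\<^esub> j},
    vee = vee L, wedge = wedge L, imp = (\<lambda>x y. (x \<leadsto>\<^bsub>L\<^esub> y) \<sqinter>\<^bsub>L\<^esub> j),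
    dqn = (\<lambda>x. \<sim>\<^bsub>L\<^esub> x \<sqinter>\<^bsub>L\<^esub> j), zero = \<zero>\<^bsub>L\<^esub>, one = j\<rparr>"

context dqd
begin

lemma algebra_interval_alg: "j \<in> carrier L \<Longrightarrow> algebra (interval_alg L j)"
  by unfold_locales
    (auto simp: interval_alg_def vee_closed wedge_closed imp_closed dqn_closed zero_closed zero_le
      le_refl wedge_le2 vee_leI intro: le_trans[OF wedge_le1])

lemma wedge_hom_interval_alg:
  assumes [simp]: "j \<in> carrier L" and "j \<sqinter> \<sim> j = \<zero>"
  shows "(\<lambda>x. x \<sqinter> j) \<in> hom L (interval_alg L j)"
proof -
  note [simp] = vee_closed wedge_closed imp_closed dqn_closed unit_simps
  have w: "(x \<sqinter> y) \<sqinter> j = (x \<sqinter> j) \<sqinter> (y \<sqinter> j)" if "x \<in> carrier L" "y \<in> carrier L" for x y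
    using that by (metis assms(1) wedge_assoc wedge_commute wedge_idem wedge_closed)
  have i: "(x \<leadsto> y) \<sqinter> j = (x \<sqinter> j \<leadsto> y \<sqinter> j) \<sqinter> j" if "x \<in> carrier L" "y \<in> carrier L" for x y
    using that wedge_imp_distrib[of j x y] by (simp add: wedge_commute[of _ j])
  show ?thesis
    using assms(2)
    by (auto simp: hom_def interval_alg_def wedge_le2 vee_wedge_distrib
        intro: w i dqn_wedge_relative)
qed

text \<open>If \<open>j \<squnion> k = \<one>\<close> and both \<open>j\<close> and \<open>k\<close> define interval quotients, truncation embeds the algebra
  subdirectly into the two intervals.\<close>

lemma subdirectly_irreducible_indecomposable:
  assumes si: "subdirectly_irreducible L" and [simp]: "j \<in> carrier L" "k \<in> carrier L"
    and jk: "j \<squnion> k = \<one>" and j: "j \<sqinter> \<sim> j = \<zero>" and k: "k \<sqinter> \<sim> k = \<zero>"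
  shows "j = \<one> \<or> k = \<one>"
proof -
  note [simp] = vee_closed wedge_closed imp_closed dqn_closed unit_simps
  define \<beta> where "\<beta> = (\<lambda>x. \<lambda>i\<in>{j, k}. x \<sqinter> i)"
  have hom: "(\<lambda>x. x \<sqinter> i) \<in> hom L (interval_alg L i)" if "i \<in> {j, k}" for i
    using that j k by (auto intro: wedge_hom_interval_alg)
  have 1: "\<forall>i\<in>{j, k}. algebra (interval_alg L i)"
    by (simp add: algebra_interval_alg)
  have 2: "\<beta> \<in> hom L (prod_alg {j, k} (interval_alg L))"
    unfolding \<beta>_def by (rule hom_prod_algI[OF algebra_axioms hom])
  have 3: "inj_on \<beta> (carrier L)"
  proof (rule inj_onI)
    fix x y assume xy: "x \<in> carrier L" "y \<in> carrier L" and eq: "\<beta> x = \<beta> y"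
    have "x \<sqinter> j = y \<sqinter> j" "x \<sqinter> k = y \<sqinter> k"
      using fun_cong[OF eq, of j] fun_cong[OF eq, of k] by (simp_all add: \<beta>_def)
    then have "x \<sqinter> (j \<squnion> k) = y \<sqinter> (j \<squnion> k)" using xy by (simp add: wedge_vee_distrib)
    then show "x = y" using xy by (simp add: jk)
  qed
  have 4: "(\<lambda>x. \<beta> x i) ` carrier L = carrier (interval_alg L i)" if "i \<in> {j, k}" for i
  proof -
    have "(\<lambda>x. x \<sqinter> i) ` carrier L = carrier (interval_alg L i)"
      using that by (auto simp: interval_alg_def le_def image_iff wedge_assoc wedge_idem intro: sym)
    then show ?thesis using that by (simp add: \<beta>_def)
  qed
  have "subdirect_embedding L {j, k} (interval_alg L) \<beta>"
    using 1 2 3 4 unfolding subdirect_embedding_def by blast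
  from subdirectly_irreducibleD[OF algebra_axioms si this]
  obtain i where i: "i \<in> {j, k}" and "(\<lambda>x. \<beta> x i) \<in> iso L (interval_alg L i)" by blast
  then have "inj_on (\<lambda>x. \<beta> x i) (carrier L)" by (simp add: iso_def bij_betw_def)
  moreover have "\<beta> \<one> i = \<beta> i i" using i by (auto simp: \<beta>_def wedge_idem)
  ultimately have "\<one> = i" using i by (auto dest: inj_onD)
  with i show ?thesis by auto
qed

end

section \<open>Algebras in the variety \<open>JIDL\<^sub>1\<close>\<close>

context jidl1
begin

lemma heyting: "heyting L"
  by (rule heyting_if_prelinear) (rule linear)

lemma dqn_vee_star: "x \<in> carrier L \<Longrightarrow> \<sim> x \<squnion> \<star> (\<sim> x) = \<one>"
  using dqn_vee_imp[of x "\<sim> x" \<zero>]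
  by (simp add: star_def dqn_closed zero_closed vee_idem vee_zero imp_self)

text \<open>The element \<open>y = x \<sqinter> \<star> (\<sim> x)\<close> satisfies \<open>y = \<star> (\<sim> y)\<close>, which makes \<open>\<sim> y\<close> its complement.\<close>

lemma wedge_star_dqn_zero_if_subdirectly_irreducible:
  assumes si: "subdirectly_irreducible L" and x: "x \<in> carrier L" "x \<noteq> \<one>"
  shows "x \<sqinter> \<star> (\<sim> x) = \<zero>"
proof -
  note [simp] = dqn_closed star_closed wedge_closed x(1)
  define y where "y = x \<sqinter> \<star> (\<sim> x)"
  have [simp]: "y \<in> carrier L" by (simp add: y_def)
  have y: "\<star> (\<sim> y) = y" using level_one[OF x(1)] by (simp add: y_def)
  have join: "y \<squnion> \<sim> y = \<one>"
    using dqn_vee_star[of y] by (simp add: y vee_commute)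
  have meet: "y \<sqinter> \<sim> y = \<zero>"
    using wedge_star[of "\<sim> y"] by (simp add: y wedge_commute)
  have "\<sim> y \<sqinter> \<sim> \<sim> y \<sqsubseteq> y \<sqinter> \<sim> y"
    by (intro le_wedgeI) (auto intro: wedge_le1 le_trans[OF wedge_le2 dqn_dqn_le])
  then have "\<sim> y \<sqinter> \<sim> \<sim> y = \<zero>"
    unfolding meet by (intro le_antisym zero_le) (simp_all add: zero_closed)
  with subdirectly_irreducible_indecomposable[OF si _ _ join meet]
  have "y = \<one> \<or> \<sim> y = \<one>" by simp
  then show ?thesis
  proof
    assume "y = \<one>"
    then have "x = \<one>" using wedge_le1[of x "\<star> (\<sim> x)"] by (simp add: y_def le_def one_wedge)
    with x show ?thesis by simp
  next
    assume "\<sim> y = \<one>"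
    then have "y = \<zero>" using meet by (simp add: wedge_one)
    then show ?thesis by (simp add: y_def)
  qed
qed

end

text \<open>The nontrivial members of the variety in which \<open>x \<sqinter> \<star> (\<sim> x)\<close> vanishes away from \<open>\<one>\<close>.\<close>

locale jidl1_vanishing = jidl1 +
  assumes vanishing: "\<lbrakk>x \<in> carrier L; x \<noteq> \<one>\<rbrakk> \<Longrightarrow> x \<sqinter> \<star> (\<sim> x) = \<zero>"
    and zero_neq_one: "\<zero> \<noteq> \<one>"
begin

lemma le_dqn:
  assumes [simp]: "x \<in> carrier L" and "x \<noteq> \<one>"
  shows "x \<sqsubseteq> \<sim> x"
proof -
  note [simp] = dqn_closed star_closed wedge_closed
  have "x = x \<sqinter> (\<sim> x \<squnion> \<star> (\<sim> x))" by (simp add: dqn_vee_star wedge_one)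
  also have "\<dots> = x \<sqinter> \<sim> x"
    by (simp add: wedge_vee_distrib vanishing[OF assms] vee_zero)
  finally show ?thesis by (simp add: le_def)
qed

lemma dqn_cases:
  assumes [simp]: "x \<in> carrier L" and "x \<noteq> \<one>"
  shows "\<sim> x = \<one> \<or> \<sim> x = x"
proof (intro disjCI)
  assume "\<sim> x \<noteq> x"
  show "\<sim> x = \<one>"
  proof (rule ccontr)
    assume "\<sim> x \<noteq> \<one>"
    then have "\<sim> x \<sqsubseteq> x"
      by (intro le_trans[OF le_dqn dqn_dqn_le]) (simp_all add: dqn_closed)
    with le_dqn[OF assms] \<open>\<sim> x \<noteq> x\<close> show False by (auto dest: le_antisym simp: dqn_closed)
  qed
qed

text \<open>Without fixed points, \<open>\<sim>\<close> takes only the values \<open>\<zero>\<close> and \<open>\<one>\<close>; the join law for \<open>\<sim> \<sim>\<close> then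
  makes \<open>\<one>\<close> join-irreducible, and prelinearity gives a chain.\<close>

lemma dsth_chain_if_no_fixed_point:
  assumes nofix: "\<And>x. x \<in> carrier L \<Longrightarrow> \<sim> x \<noteq> x"
  shows "dsth_chain L"
proof -
  interpret heyting L by (rule heyting)
  note [simp] = vee_closed wedge_closed imp_closed dqn_closed unit_simps
  have one: "\<sim> x = \<one>" if "x \<in> carrier L" "x \<noteq> \<one>" for x
    using dqn_cases[OF that] nofix[OF that(1)] by blast
  have irred: "u = \<one> \<or> v = \<one>" if "u \<in> carrier L" "v \<in> carrier L" "u \<squnion> v = \<one>" for u v
  proof (rule ccontr)
    assume "\<not> (u = \<one> \<or> v = \<one>)"
    then have "\<sim> \<sim> u = \<zero>" "\<sim> \<sim> v = \<zero>" using one that by (simp_all add: dqn_one)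
    then have "\<sim> \<sim> \<one> = \<zero>" using dqn_dqn_vee[OF that(1,2)] that(3) by simp
    then show False using zero_neq_one by (simp add: dqn_one dqn_zero)
  qed
  show ?thesis
  proof unfold_locales
    fix x assume "x \<in> carrier L"
    then show "\<sim> x \<sqinter> \<sim> \<sim> x = \<zero>"
      using one[of x] by (cases "x = \<one>") (auto simp: dqn_one dqn_zero)
  next
    fix x y assume xy: "x \<in> carrier L" "y \<in> carrier L"
    then show "x \<sqsubseteq> y \<or> y \<sqsubseteq> x"
      using irred[OF _ _ linear[of x y]] imp_one_le by auto
  qed
qed

text \<open>A fixed point \<open>a\<close> of \<open>\<sim>\<close> is complemented, its complement \<open>b\<close> is again a fixed point, and
  comparing an arbitrary element with both leaves only \<open>\<zero>\<close>, \<open>a\<close>, \<open>b\<close> and \<open>\<one>\<close>.\<close>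

lemma fixed_point_carrier:
  assumes [simp]: "a \<in> carrier L" and a: "\<sim> a = a"
  shows "carrier L = {\<zero>, a, \<star> a, \<one>}" "\<sim> (\<star> a) = \<star> a" "a \<sqinter> \<star> a = \<zero>" "a \<squnion> \<star> a = \<one>"
    "distinct [\<zero>, a, \<star> a, \<one>]"
proof -
  note [simp] = vee_closed wedge_closed imp_closed dqn_closed star_closed unit_simps
  define b where "b = \<star> a"
  have [simp]: "b \<in> carrier L" by (simp add: b_def)
  have ab: "a \<sqinter> b = \<zero>" "a \<squnion> b = \<one>"
    using wedge_star[of a] dqn_vee_star[of a] by (simp_all add: a b_def)
  have a01: "a \<noteq> \<zero>" "a \<noteq> \<one>" using a dqn_zero dqn_one zero_neq_one by auto
  have b01: "b \<noteq> \<zero>" "b \<noteq> \<one>" using ab a01 by auto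
  \<comment> \<open>If \<open>\<sim> x = \<one>\<close> and \<open>\<sim> c = c\<close>, then \<open>\<sim> \<sim> (c \<squnion> x) = c\<close> is neither \<open>\<zero>\<close> nor \<open>\<one>\<close>, so
    \<open>c \<squnion> x\<close> is itself a fixed point and equals \<open>c\<close>. Elements sent to \<open>\<one>\<close> lie below every fixed point.\<close>
  have below: "x \<sqsubseteq> c" if [simp]: "x \<in> carrier L" "c \<in> carrier L" and "\<sim> x = \<one>" "\<sim> c = c" for x c
  proof -
    have c1: "c \<noteq> \<one>" using that dqn_one zero_neq_one by auto
    have c0: "c \<noteq> \<zero>" using that dqn_zero zero_neq_one by auto
    have eq: "\<sim> \<sim> (c \<squnion> x) = c"
      using dqn_dqn_vee[of c x] that by (simp add: dqn_one)
    then have ne: "c \<squnion> x \<noteq> \<one>" using c1 dqn_one dqn_zero by auto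
    have "\<sim> (c \<squnion> x) \<noteq> \<one>" using eq c0 dqn_one by auto
    with dqn_cases[of "c \<squnion> x"] ne have "\<sim> (c \<squnion> x) = c \<squnion> x" by simp
    with eq have "c \<squnion> x = c" by simp
    then show ?thesis using le_vee2[of c x] by simp
  qed
  have b: "\<sim> b = b"
  proof (rule ccontr)
    assume "\<sim> b \<noteq> b"
    then have "\<sim> b = \<one>" using dqn_cases[of b] b01 by simp
    then have "b \<sqsubseteq> a" using below[of b a] a by simp
    then have "b = \<zero>" using ab by (simp add: le_def wedge_commute)
    with b01 show False by simp
  qed
  \<comment> \<open>For fixed points, \<open>\<sim> (c \<sqinter> x) = c \<squnion> x\<close>, and \<open>\<sim>\<close> maps \<open>c \<sqinter> x\<close> to \<open>\<one>\<close> or to itself.\<close>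
  have fix_cases: "x = c \<or> c \<squnion> x = \<one>"
    if [simp]: "x \<in> carrier L" "c \<in> carrier L" and "\<sim> x = x" "\<sim> c = c" "c \<noteq> \<one>" for x c
  proof -
    have ne: "c \<sqinter> x \<noteq> \<one>"
      using that(5) by (metis le_def le_one one_wedge that(2) le_antisym wedge_le1 that(1) one_closed)
    have "\<sim> (c \<sqinter> x) = c \<squnion> x" using dqn_wedge[of c x] that by simp
    with dqn_cases[of "c \<sqinter> x"] ne have "c \<squnion> x = \<one> \<or> c \<squnion> x = c \<sqinter> x" by auto
    then show ?thesis
    proof
      assume eq: "c \<squnion> x = c \<sqinter> x"
      have "x \<sqsubseteq> c" "c \<sqsubseteq> x"
        using le_vee1[of c x] le_vee2[of c x] wedge_le1[of c x] wedge_le2[of c x]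
        unfolding eq by (auto intro: le_trans[of _ "c \<sqinter> x"])
      then show ?thesis by (simp add: le_antisym)
    qed simp
  qed
  have "x \<in> {\<zero>, a, b, \<one>}" if [simp]: "x \<in> carrier L" for x
  proof (cases "x = \<one>")
    case x1: False
    show ?thesis
    proof (cases "\<sim> x = \<one>")
      case True
      then have "x \<sqsubseteq> a \<sqinter> b" using a b by (intro le_wedgeI below) simp_all
      then have "x = \<zero>" unfolding ab by (intro le_antisym zero_le) simp_all
      then show ?thesis by simp
    next
      case False
      then have x: "\<sim> x = x" using dqn_cases[of x] x1 by simp
      show ?thesis
      proof (rule ccontr)
        assume "x \<notin> {\<zero>, a, b, \<one>}"
        then have *: "a \<squnion> x = \<one>" "b \<squnion> x = \<one>"
          using fix_cases[of x a] fix_cases[of x b] x a b a01 b01 by auto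
        have "b \<sqinter> (a \<squnion> x) = b \<sqinter> x"
          using ab(1) by (simp add: wedge_vee_distrib wedge_commute[of b a])
        then have "b \<sqsubseteq> x" using * by (simp add: le_def)
        then have "x = \<one>" using * by (simp add: le_iff_vee)
        with x1 show False ..
      qed
    qed
  qed simp
  then show "carrier L = {\<zero>, a, \<star> a, \<one>}" by (auto simp: b_def)
  show "\<sim> (\<star> a) = \<star> a" "a \<sqinter> \<star> a = \<zero>" "a \<squnion> \<star> a = \<one>" using b ab by (simp_all add: b_def)
  have "a \<noteq> b" using ab a01 by (auto simp: wedge_idem)
  then show "distinct [\<zero>, a, \<star> a, \<one>]" using a01 b01 zero_neq_one by (auto simp: b_def)
qed

lemma iso_D2_if_fixed_point:
  assumes [simp]: "a \<in> carrier L" and a: "\<sim> a = a"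
  shows "L \<cong> D2"
proof -
  interpret heyting L by (rule heyting)
  note [simp] = vee_closed wedge_closed imp_closed dqn_closed star_closed unit_simps
  define b where "b = \<star> a"
  have [simp]: "b \<in> carrier L" by (simp add: b_def)
  note f = fixed_point_carrier[OF assms, folded b_def]
  have ne: "a \<noteq> \<zero>" "b \<noteq> \<zero>" "a \<noteq> \<one>" "b \<noteq> \<one>" "a \<noteq> b" "\<zero> \<noteq> \<one>" using f(5) by auto
  have comm: "b \<sqinter> a = \<zero>" "b \<squnion> a = \<one>"
    using f(3,4) by (simp_all add: wedge_commute vee_commute)
  have imp_eq: "x \<leadsto> y = y"
    if "{x, y} = {a, b}" for x y
  proof -
    have [simp]: "x \<in> carrier L" "y \<in> carrier L" and xy: "x \<sqinter> y = \<zero>" "x \<squnion> y = \<one>"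
      using that f(3,4) comm by (auto simp: doubleton_eq_iff)
    have "x \<leadsto> y = (x \<squnion> y) \<sqinter> (x \<leadsto> y)" by (simp add: xy)
    also have "\<dots> = (x \<sqinter> (x \<leadsto> y)) \<squnion> (y \<sqinter> (x \<leadsto> y))" by (rule vee_wedge_distrib) simp_all
    also have "\<dots> = y"
      using wedge_imp[of x y] le_imp[of x y] by (simp add: xy le_def)
    finally show ?thesis .
  qed
  have a0: "a \<leadsto> \<zero> = b" by (simp add: b_def star_def)
  have b0: "b \<leadsto> \<zero> = a"
  proof -
    have j: "b \<squnion> (b \<leadsto> \<zero>) = \<one>" using dqn_vee_star[of b] f(2) by (simp add: star_def)
    have m: "b \<sqinter> (b \<leadsto> \<zero>) = \<zero>" using wedge_imp[of b \<zero>] by simp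
    have "b \<leadsto> \<zero> \<in> {\<zero>, a, b, \<one>}" using f(1) imp_closed[of b \<zero>] by auto
    then show ?thesis using j m ne by (auto simp: wedge_idem vee_idem)
  qed
  have "a \<leadsto> b = b" "b \<leadsto> a = a" by (rule imp_eq; blast)+
  note imps = this a0 b0 one_imp imp_self le_imp_one[OF le_one] le_imp_one[OF zero_le]
  \<comment> \<open>The coordinates of \<open>x\<close> record whether \<open>a\<close> and \<open>b\<close> lie below \<open>x\<close>.\<close>
  define h where "h x = (x = a \<or> x = \<one>, x = b \<or> x = \<one>)" for x
  have h: "h \<zero> = (False, False)" "h a = (True, False)" "h b = (False, True)" "h \<one> = (True, True)"
    by (simp_all add: h_def ne ne[symmetric])
  have "h \<in> hom L D2"
    unfolding hom_def f(1)
    by (simp add: h D2_def bot_prod_def top_prod_def a f(2-4) comm imps dqn_zero dqn_one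
        wedge_idem vee_idem)
  moreover have "bij_betw h (carrier L) (carrier D2)"
  proof (rule bij_betw_imageI)
    show "inj_on h (carrier L)"
      unfolding f(1) inj_on_def by (auto simp: h)
    have "(p, q) \<in> h ` carrier L" for p q
      unfolding f(1) by (cases p; cases q) (auto simp: h)
    then show "h ` carrier L = carrier D2" by (auto simp: D2_def)
  qed
  ultimately show ?thesis by (auto simp: is_iso_def iso_def)
qed

lemma classification: "L \<cong> D2 \<or> dsth_chain L"
  using iso_D2_if_fixed_point dsth_chain_if_no_fixed_point by blast

end

section \<open>The algebra \<open>D\<^sub>2\<close> and the chains\<close>

lemma jidl1_D2: "jidl1 D2"
  by unfold_locales
    (auto simp: D2_def le_def star_def bot_prod_def top_prod_def split: if_splits)

lemma D2_vanishing: "x \<noteq> \<one>\<^bsub>D2\<^esub> \<Longrightarrow> x \<sqinter>\<^bsub>D2\<^esub> \<star>\<^bsub>D2\<^esub> (\<sim>\<^bsub>D2\<^esub> x) = \<zero>\<^bsub>D2\<^esub>"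
  by (cases x) (auto simp: D2_def star_def bot_prod_def top_prod_def)

lemma (in dqd) jidl1_vanishing_if_iso_D2:
  assumes "L \<cong> D2"
  shows "jidl1 L" and "\<And>x. \<lbrakk>x \<in> carrier L; x \<noteq> \<one>\<rbrakk> \<Longrightarrow> x \<sqinter> \<star> (\<sim> x) = \<zero>"
proof -
  interpret D: jidl1 D2 by (rule jidl1_D2)
  note [simp] = vee_closed wedge_closed imp_closed dqn_closed star_closed zero_closed one_closed
  obtain h where h: "h \<in> hom L D2" and bij: "bij_betw h (carrier L) (carrier D2)"
    using assms by (auto simp: is_iso_def iso_def)
  have eqI: "x = y" if "h x = h y" "x \<in> carrier L" "y \<in> carrier L" for x y
    using bij that by (auto simp: bij_betw_def dest: inj_onD)
  have [simp]: "h x \<in> carrier D2" for x by (simp add: D2_def)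
  have [simp]: "h (x \<squnion> y) = h x \<squnion>\<^bsub>D2\<^esub> h y" "h (x \<sqinter> y) = h x \<sqinter>\<^bsub>D2\<^esub> h y"
    "h (x \<leadsto> y) = h x \<leadsto>\<^bsub>D2\<^esub> h y"
    if "x \<in> carrier L" "y \<in> carrier L" for x y
    using h that by (auto simp: hom_def)
  have [simp]: "h \<zero> = \<zero>\<^bsub>D2\<^esub>" "h \<one> = \<one>\<^bsub>D2\<^esub>" using h by (auto simp: hom_def)
  have [simp]: "h (\<sim> x) = \<sim>\<^bsub>D2\<^esub> (h x)" "h (\<star> x) = \<star>\<^bsub>D2\<^esub> (h x)" if "x \<in> carrier L" for x
    using h that by (auto simp: hom_def star_def)
  show "jidl1 L"
  proof unfold_locales
    fix x y z assume [simp]: "x \<in> carrier L" "y \<in> carrier L" "z \<in> carrier L"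
    show "\<sim> x \<squnion> (y \<leadsto> z) = (\<sim> x \<squnion> y) \<leadsto> (\<sim> x \<squnion> z)"
      using D.dqn_vee_imp[of "h x" "h y" "h z"] by (intro eqI) simp_all
  next
    fix x y assume [simp]: "x \<in> carrier L" "y \<in> carrier L"
    show "(x \<leadsto> y) \<squnion> (y \<leadsto> x) = \<one>"
      using D.linear[of "h x" "h y"] by (intro eqI) simp_all
  next
    fix x assume [simp]: "x \<in> carrier L"
    show "x \<sqinter> \<star> (\<sim> x) = \<star> (\<sim> (x \<sqinter> \<star> (\<sim> x)))"
      using D.level_one[of "h x"] by (intro eqI) simp_all
  qed
  fix x assume [simp]: "x \<in> carrier L" and "x \<noteq> \<one>"
  then have "h x \<noteq> \<one>\<^bsub>D2\<^esub>" using eqI[of x \<one>] by auto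
  then show "x \<sqinter> \<star> (\<sim> x) = \<zero>"
    using D2_vanishing[of "h x"] by (intro eqI) simp_all
qed

context dsth_chain
begin

lemma dqn_eq_one:
  assumes [simp]: "x \<in> carrier L" and "x \<noteq> \<one>"
  shows "\<sim> x = \<one>"
proof -
  note [simp] = dqn_closed unit_simps
  have "\<sim> x = \<zero> \<or> \<sim> \<sim> x = \<zero>"
    using chain[of "\<sim> x" "\<sim> \<sim> x"] dqn_wedge_dqn_dqn[of x]
    by (auto simp: le_def wedge_commute)
  then show ?thesis
  proof
    assume "\<sim> x = \<zero>"
    then have "x = \<one>" using dqn_dqn_le[of x] by (simp add: dqn_zero le_def)
    with assms show ?thesis by simp
  next
    assume "\<sim> \<sim> x = \<zero>"
    then show ?thesis using dqn_dqn_dqn[of x] by (simp add: dqn_zero)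
  qed
qed

lemma vanishing:
  assumes [simp]: "x \<in> carrier L" and "x \<noteq> \<one>"
  shows "x \<sqinter> \<star> (\<sim> x) = \<zero>"
  using dqn_eq_one[OF assms] by (simp add: star_def one_imp unit_simps)

lemma jidl1: "jidl1 L"
proof unfold_locales
  note [simp] = vee_closed wedge_closed imp_closed dqn_closed star_closed unit_simps
  fix x y z assume [simp]: "x \<in> carrier L" "y \<in> carrier L" "z \<in> carrier L"
  show "\<sim> x \<squnion> (y \<leadsto> z) = (\<sim> x \<squnion> y) \<leadsto> (\<sim> x \<squnion> z)"
    using dqn_eq_one[of x] by (cases "x = \<one>") (simp_all add: dqn_one imp_self)
next
  fix x y assume [simp]: "x \<in> carrier L" "y \<in> carrier L"
  show "(x \<leadsto> y) \<squnion> (y \<leadsto> x) = \<one>"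
    using chain[of x y] by (auto simp: le_imp_one one_vee vee_one imp_closed)
next
  fix x assume [simp]: "x \<in> carrier L"
  show "x \<sqinter> \<star> (\<sim> x) = \<star> (\<sim> (x \<sqinter> \<star> (\<sim> x)))"
  proof (cases "x = \<one>")
    case True
    then show ?thesis by (simp add: dqn_one star_def imp_self unit_simps)
  next
    case False
    then show ?thesis by (simp add: vanishing dqn_zero) (simp add: star_def one_imp unit_simps)
  qed
qed

end

section \<open>The characterisation\<close>

theorem theorem6p7:
  fixes L :: "'a alg"
  assumes "dqd L"
    and "infinite (carrier L) \<or> card (carrier L) > 2"
  shows "((jidl1 L \<and> subdirectly_irreducible L) \<longleftrightarrow> (jidl1 L \<and> simple L))
    \<and> ((jidl1 L \<and> simple L) \<longleftrightarrow>
        (jidl1 L \<and> (\<forall>x\<in>carrier L. x \<noteq> \<one>\<^bsub>L\<^esub> \<longrightarrow> x \<sqinter>\<^bsub>L\<^esub> \<star>\<^bsub>L\<^esub> (\<sim>\<^bsub>L\<^esub> x) = \<zero>\<^bsub>L\<^esub>)))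
    \<and> ((jidl1 L \<and> (\<forall>x\<in>carrier L. x \<noteq> \<one>\<^bsub>L\<^esub> \<longrightarrow> x \<sqinter>\<^bsub>L\<^esub> \<star>\<^bsub>L\<^esub> (\<sim>\<^bsub>L\<^esub> x) = \<zero>\<^bsub>L\<^esub>)) \<longleftrightarrow>
        (L \<cong> D2 \<or> dsth_chain L))"
proof -
  interpret dqd L by fact
  have nt: "\<zero>\<^bsub>L\<^esub> \<noteq> \<one>\<^bsub>L\<^esub>"
  proof
    assume eq: "\<zero>\<^bsub>L\<^esub> = \<one>\<^bsub>L\<^esub>"
    have "x = \<one>\<^bsub>L\<^esub>" if "x \<in> carrier L" for x
      using one_wedge[OF that] zero_wedge[OF that] eq by simp
    then have sub: "carrier L \<subseteq> {\<one>\<^bsub>L\<^esub>}" by auto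
    then show False using assms(2) card_mono[OF _ sub] finite_subset[OF sub] by auto
  qed
  let ?V = "\<forall>x\<in>carrier L. x \<noteq> \<one>\<^bsub>L\<^esub> \<longrightarrow> x \<sqinter>\<^bsub>L\<^esub> \<star>\<^bsub>L\<^esub> (\<sim>\<^bsub>L\<^esub> x) = \<zero>\<^bsub>L\<^esub>"
  have "simple L \<Longrightarrow> subdirectly_irreducible L"
    by (rule simple_imp_subdirectly_irreducible[OF algebra_axioms _ nt])
  moreover have "?V" if "jidl1 L" "subdirectly_irreducible L"
    using jidl1.wedge_star_dqn_zero_if_subdirectly_irreducible[OF that] by blast
  moreover have "?V \<Longrightarrow> simple L"
    by (rule simple_if_wedge_star_dqn_zero) blast
  moreover have "L \<cong> D2 \<or> dsth_chain L" if "jidl1 L" "?V"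
    using jidl1_vanishing.classification[of L] that nt
    by (auto simp: jidl1_vanishing_def jidl1_vanishing_axioms_def)
  moreover have "jidl1 L \<and> ?V" if "L \<cong> D2 \<or> dsth_chain L"
    using that
  proof
    assume "L \<cong> D2"
    then show ?thesis using jidl1_vanishing_if_iso_D2 by simp
  next
    assume "dsth_chain L"
    then show ?thesis using dsth_chain.jidl1[of L] dsth_chain.vanishing[of L] by simp
  qed
  ultimately show ?thesis by blast
qed

end
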